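(* For every estimator $\widehat t:\mathcal Y\to T$, every $\Delta>0$, and every reference law $Q\in\Delta(\mathcal Y)$ with $0<\rho_{\Delta,Q}(\widehat t)<1$, \[ \mathbb P_{t\sim\pi,\,Y\sim P_t}\{d(t,\widehat t(Y))\ge\Delta\}\ge\left(1-\frac{\mathcal I_\pi(Q)+\log2}{\log(1/\rho_{\Delta,Q}(\widehat t))}\right)_+. \] Consequently, \[ \mathbb E_{t\sim\pi,\,Y\sim P_t}d(t,\widehat t(Y))\ge\sup_{\substack{\Delta>0,\,Q:\\0<\rho_{\Delta,Q}(\widehat t)<1}}\Delta\left(1-\frac{\mathcal I_\pi(Q)+\log2}{\log(1/\rho_{\Delta,Q}(\widehat t))}\right)_+. \]
   Context: $(T,d)$ is a finite metric space, $\pi\in\Delta(T)$ is a probability measure on $T$ (known prior), and $\{P_t:t\in T\}$ is a family of probability measures (an experiment) on a measurable space $\mathcal Y$. $\Delta(\mathcal Y)$ is the set of probability measures on $\mathcal Y$; estimators are measurable maps. For an estimator $\widehat t$, a law $Q\in\Delta(\mathcal Y)$ and $\Delta>0$, \[ \rho_{\Delta,Q}(\widehat t):=\mathbb P_{t\sim\pi,\,Y\sim Q}\{d(t,\widehat t(Y))<\Delta\} \] where $t$ and $Y$ are independent under this law, and \[ \mathcal I_\pi(Q):=\mathbb E_{t\sim\pi}D_{\mathrm{KL}}(P_t\|Q) \] (the value $+\infty$ is allowed, in which case the bound is the trivial one). $(u)_+=\max\{u,0\}$. *)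

theory Defs
  imports "HOL-Probability.Probability"
begin

text \<open>
  \<open>D\<^sub>K\<^sub>L(P\<parallel>Q)\<close> in nats, with values in \<open>[0,\<infinity>]\<close>. The library's \<^const>\<open>KL_divergence\<close> takes the
  reference measure first and is real-valued, hence meaningless when the divergence is infinite.
  For probability measures the negative part of the log-density is always \<open>P\<close>-integrable, so
  failure of integrability means that the integral is \<open>+\<infinity>\<close>; in the remaining case the value is
  nonnegative, so \<^const>\<open>ennreal\<close> does not truncate it.
\<close>
definition KL :: "'b measure \<Rightarrow> 'b measure \<Rightarrow> ennreal" where
  "KL P Q =
    (if absolutely_continuous Q P \<and> integrable P (entropy_density (exp 1) Q P)
     then ennreal (KL_divergence (exp 1) Q P) else \<infinity>)"

definition avg_KL :: "'a measure \<Rightarrow> ('a \<Rightarrow> 'b measure) \<Rightarrow> 'b measure \<Rightarrow> ennreal" where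
  "avg_KL \<pi> P Q = (\<integral>\<^sup>+ t. KL (P t) Q \<partial>\<pi>)"

text \<open>The law of \<open>(t, y)\<close> with \<open>t \<sim> \<pi>\<close> and, given \<open>t\<close>, \<open>y \<sim> P t\<close>.\<close>
definition joint_law ::
    "'a measure \<Rightarrow> 'b measure \<Rightarrow> ('a \<Rightarrow> 'b measure) \<Rightarrow> ('a \<times> 'b) measure" where
  "joint_law \<pi> Y P = \<pi> \<bind> (\<lambda>t. P t \<bind> (\<lambda>y. return (\<pi> \<Otimes>\<^sub>M Y) (t, y)))"

definition rho ::
    "('a \<Rightarrow> 'a \<Rightarrow> real) \<Rightarrow> 'a measure \<Rightarrow> real \<Rightarrow> 'b measure \<Rightarrow> ('b \<Rightarrow> 'a) \<Rightarrow> real" where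
  "rho d \<pi> \<Delta> Q est = \<P>((t, y) in \<pi> \<Otimes>\<^sub>M Q. d t (est y) < \<Delta>)"

text \<open>Extended-real valued because \<^const>\<open>avg_KL\<close> may be infinite; the bound is then \<open>0\<close>.\<close>
definition fano_bound ::
    "('a \<Rightarrow> 'a \<Rightarrow> real) \<Rightarrow> 'a measure \<Rightarrow> ('a \<Rightarrow> 'b measure) \<Rightarrow> real \<Rightarrow> 'b measure
      \<Rightarrow> ('b \<Rightarrow> 'a) \<Rightarrow> ereal" where
  "fano_bound d \<pi> P \<Delta> Q est =
    max (1 - (enn2ereal (avg_KL \<pi> P Q) + ereal (ln 2)) / ereal (ln (1 / rho d \<pi> \<Delta> Q est))) 0"

end

(* Change of measure (Donsker-Varadhan): for the event A_t = {d(t, est Y) < Delta} and the test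
   function f = log(1/rho) 1_{A_t},
     P_t(A_t) log(1/rho) <= KL(P_t||Q) + log E_Q e^f,   E_Q e^f = 1 + Q(A_t) (1/rho - 1).
   Since rho is the pi-average of Q(A_t), the average of E_Q e^f is 2 - rho <= 2.  Replacing the
   logarithm by its tangent at 2, log x <= x/2 + log 2 - 1, makes the bound affine in Q(A_t), so that
   averaging over pi needs no Jensen inequality.  The bound on the mean is then Markov's inequality. *)
theory Submission imports Defs begin

text \<open>A product of finite discrete spaces is discrete, so an arbitrary real loss
  \<open>f\<close> on it is measurable, and it suffices that (t, y) maps measurably to (t,
  \<open>est y\<close>).\<close>

lemma borel_measurable_pair_finite:
  fixes f :: "'a \<Rightarrow> 'a \<Rightarrow> real"
  assumes "finite T" "sets \<pi> = sets (count_space T)" "est \<in> Y \<rightarrow>\<^sub>M count_space T"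
  shows "(\<lambda>(t, y). f t (est y)) \<in> borel_measurable (\<pi> \<Otimes>\<^sub>M Y)"
proof -
  have "(\<lambda>(t, y). (t, est y)) \<in> \<pi> \<Otimes>\<^sub>M Y \<rightarrow>\<^sub>M count_space T \<Otimes>\<^sub>M count_space T"
    using assms(3) measurable_ident_sets[OF assms(2)] by measurable
  then have "(\<lambda>(t, y). (t, est y)) \<in> \<pi> \<Otimes>\<^sub>M Y \<rightarrow>\<^sub>M count_space (T \<times> T)"
    by (simp add: pair_measure_countable assms(1) countable_finite)
  then have "(\<lambda>z. case_prod f (case z of (t, y) \<Rightarrow> (t, est y))) \<in> borel_measurable (\<pi> \<Otimes>\<^sub>M Y)"
    by (rule measurable_compose) simp
  then show ?thesis by (simp add: case_prod_unfold)
qed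

text \<open>This is the change of measure for one event, with log replaced by its tangent at
  \<open>c\<close>: ln x \<le> x / c + ln c - 1. The right-hand side is affine in
  \<open>measure Q A\<close>; optimising over \<open>c\<close> would restore the logarithm.\<close>

lemma KL_event_bound:
  assumes PQ: "prob_space P" "prob_space Q" "sets P = sets Q" "A \<in> sets Q"
    and fin: "KL P Q \<noteq> \<infinity>" and r: "0 < r" and c: "0 < c"
  shows "measure P A * ln (1 / r) \<le>
    enn2real (KL P Q) + (1 + measure Q A * (1 / r - 1)) / c + ln c - 1"
proof -
  interpret P: prob_space P by fact
  interpret Q: prob_space Q by fact
  define L where "L = ln (1 / r)"
  define h where "h = entropy_density (exp 1) Q P"
  \<comment> \<open>A finite \<open>KL\<close> can only come from the first branch of its
    definition, which supplies both facts.\<close>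
  have ac: "absolutely_continuous Q P" and int: "integrable P h"
    using fin by (auto simp: KL_def h_def split: if_splits)
  obtain D where D: "D \<in> borel_measurable Q" "AE x in Q. RN_deriv Q P x = ennreal (D x)"
      "AE x in P. 0 < D x" "\<And>x. 0 \<le> D x"
    using Q.real_RN_deriv[OF P.finite_measure_axioms ac PQ(3)] by blast
  have dens: "P = density Q (\<lambda>x. ennreal (D x))"
    using Q.density_RN_deriv[OF ac PQ(3)] density_cong[OF _ _ D(2)] D(1) by simp
  \<comment> \<open>\<open>D\<close> represents the derivative only \<open>Q\<close>-a.e.; absolute
    continuity carries the identity over to \<open>P\<close>.\<close>
  have hD: "AE x in P. h x = ln (D x)"
  proof -
    have "AE x in P. RN_deriv Q P x = ennreal (D x)"
      using absolutely_continuous_AE[OF PQ(3) ac D(2)] .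
    then show ?thesis
      by eventually_elim (simp add: h_def entropy_density_def D(4) log_def)
  qed
  let ?I = "indicator A :: _ \<Rightarrow> real"
  let ?f = "\<lambda>x. 1 + ?I x * (1 / r - 1)"
  have AP: "A \<in> sets P" using PQ by simp
  have hm: "h \<in> borel_measurable Q"
    using borel_measurable_integrable[OF int] PQ(3) by (simp cong: measurable_cong_sets)
  have intg: "integrable P (\<lambda>x. ?I x * L - h x - (ln c - 1))"
    using int AP by (auto simp: less_top[symmetric])
  \<comment> \<open>\<open>?f = exp (L * ?I)\<close>, so this is the Fenchel--Young inequality for \<open>u ln u\<close>, shifted by \<open>ln c\<close>.\<close>
  have pt: "D x * (?I x * L - ln (D x) - (ln c - 1)) \<le> ?f x / c" for x
  proof (cases "D x = 0")
    case True
    then show ?thesis using r c by (auto simp: indicator_def)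
  next
    case False
    then have Dp: "0 < D x" using D(4)[of x] by simp
    have fp: "0 < ?f x" using r by (auto simp: indicator_def)
    have "?I x * L = ln (?f x)" using r by (auto simp: indicator_def L_def)
    \<comment> \<open>The only inequality used pointwise: ln u \<le> u - 1, tight when
      \<open>D\<close> equals \<open>?f / c\<close>. Multiplying by \<open>D x\<close> then clears
      the denominator.\<close>
    moreover have "ln (?f x / (c * D x)) \<le> ?f x / (c * D x) - 1"
      using fp c Dp by (intro ln_le_minus_one) simp
    moreover have "ln (?f x / (c * D x)) = ln (?f x) - ln c - ln (D x)"
      using fp c Dp by (simp add: ln_div ln_mult)
    ultimately have "?I x * L - ln (D x) - (ln c - 1) \<le> ?f x / (c * D x)" by linarith
    then have "D x * (?I x * L - ln (D x) - (ln c - 1)) \<le> D x * (?f x / (c * D x))"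
      using Dp by (intro mult_left_mono) auto
    then show ?thesis using Dp by simp
  qed
  have "measure P A * L - (\<integral>x. h x \<partial>P) - (ln c - 1) = (\<integral>x. ?I x * L - h x - (ln c - 1) \<partial>P)"
    using int AP by (simp add: less_top[symmetric] P.prob_space)
  also have "\<dots> = (\<integral>x. ?I x * L - ln (D x) - (ln c - 1) \<partial>P)"
    using hD hm D(1) PQ(3,4) by (intro integral_cong_AE) (auto cong: measurable_cong_sets)
  \<comment> \<open>The expectation moves from \<open>P\<close> to \<open>Q\<close> with
    \<open>D\<close> as weight, which is the form bounded by \<open>pt\<close>.\<close>
  also have "\<dots> = (\<integral>x. D x * (?I x * L - ln (D x) - (ln c - 1)) \<partial>Q)"
    unfolding dens using D(1,4) PQ(4) by (subst integral_density) auto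
  also have "\<dots> \<le> (\<integral>x. ?f x / c \<partial>Q)"
  proof (rule integral_mono)
    \<comment> \<open>Integrability under \<open>Q\<close> is inherited from that of the log-density
      under \<open>P\<close>, hence from finiteness of \<open>KL\<close>.\<close>
    have "integrable P (\<lambda>x. ?I x * L - ln (D x) - (ln c - 1))"
      using intg hD hm D(1) PQ(3,4)
      by (subst integrable_cong_AE[where g = "\<lambda>x. ?I x * L - h x - (ln c - 1)"])
        (auto cong: measurable_cong_sets)
    then show "integrable Q (\<lambda>x. D x * (?I x * L - ln (D x) - (ln c - 1)))"
      unfolding dens using D(1,4) PQ(4) by (subst (asm) integrable_density) auto
    show "integrable Q (\<lambda>x. ?f x / c)" using PQ(4) by (auto simp: less_top[symmetric])
  qed (use pt in auto)
  also have "\<dots> = (1 + measure Q A * (1 / r - 1)) / c"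
    using PQ(4) by (simp add: less_top[symmetric] Q.prob_space)
  finally have "measure P A * L \<le> (\<integral>x. h x \<partial>P) + (1 + measure Q A * (1 / r - 1)) / c + ln c - 1"
    by simp
  \<comment> \<open>Nonnegativity of the divergence is not invoked: for a negative integral
    \<open>ennreal\<close> would truncate to 0, still an upper bound.\<close>
  moreover have "(\<integral>x. h x \<partial>P) \<le> enn2real (KL P Q)"
    using ac int by (cases "0 \<le> (\<integral>x. h x \<partial>P)")
      (simp_all add: KL_def h_def[symmetric] KL_divergence_def ennreal_neg)
  ultimately show ?thesis unfolding L_def by linarith
qed

text \<open>For fixed t the inner bind is the image of \<open>P t\<close> under y \<mapsto> (t, y),
  so the outer bind averages the masses of the sections. This turns joint probabilities into
  \<pi>-averages.\<close>

lemma
  assumes \<pi>: "\<pi> \<in> space (prob_algebra M)" and P: "P \<in> M \<rightarrow>\<^sub>M prob_algebra Y"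
  shows joint_law_in_prob_algebra: "joint_law \<pi> Y P \<in> space (prob_algebra (\<pi> \<Otimes>\<^sub>M Y))"
    and emeasure_joint_law: "X \<in> sets (\<pi> \<Otimes>\<^sub>M Y) \<Longrightarrow>
      emeasure (joint_law \<pi> Y P) X = (\<integral>\<^sup>+ t. emeasure (P t) (Pair t -` X) \<partial>\<pi>)"
proof -
  have s\<pi>: "sets \<pi> = sets M" and p\<pi>: "prob_space \<pi>"
    using \<pi> by (auto simp: space_prob_algebra)
  interpret \<pi>: prob_space \<pi> by fact
  have [measurable]: "P \<in> \<pi> \<rightarrow>\<^sub>M prob_algebra Y"
    using P measurable_cong_sets[OF s\<pi> refl] by blast
  define K where "K = (\<lambda>t. P t \<bind> (\<lambda>y. return (\<pi> \<Otimes>\<^sub>M Y) (t, y)))"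
  have K[measurable]: "K \<in> \<pi> \<rightarrow>\<^sub>M prob_algebra (\<pi> \<Otimes>\<^sub>M Y)"
    unfolding K_def by measurable
  have "\<pi> \<in> space (prob_algebra \<pi>)" using p\<pi> by (simp add: space_prob_algebra)
  from prob_space_bind'[OF this K] sets_bind'[OF this K]
  show "joint_law \<pi> Y P \<in> space (prob_algebra (\<pi> \<Otimes>\<^sub>M Y))"
    by (simp add: joint_law_def K_def space_prob_algebra)
  assume X: "X \<in> sets (\<pi> \<Otimes>\<^sub>M Y)"
  have "emeasure (joint_law \<pi> Y P) X = (\<integral>\<^sup>+ t. emeasure (K t) X \<partial>\<pi>)"
    unfolding joint_law_def K_def[symmetric]
    using emeasure_bind[OF \<pi>.not_empty measurable_prob_algebraD[OF K] X] .
  also have "\<dots> = (\<integral>\<^sup>+ t. emeasure (P t) (Pair t -` X) \<partial>\<pi>)"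
  proof (rule nn_integral_cong)
    fix t assume t: "t \<in> space \<pi>"
    have Pt: "P t \<in> space (prob_algebra Y)"
      by (rule measurable_space[OF \<open>P \<in> \<pi> \<rightarrow>\<^sub>M prob_algebra Y\<close> t])
    then have sP: "sets (P t) = sets Y" and "prob_space (P t)" by (auto simp: space_prob_algebra)
    interpret Pt: prob_space "P t" by fact
    have m: "Pair t \<in> P t \<rightarrow>\<^sub>M \<pi> \<Otimes>\<^sub>M Y"
      using measurable_Pair1'[OF t, of Y] measurable_cong_sets[OF sP refl] by blast
    have "K t = distr (P t) (\<pi> \<Otimes>\<^sub>M Y) (Pair t)"
      unfolding K_def using bind_return_distr[OF Pt.not_empty m] by (simp add: comp_def)
    moreover have "Pair t -` X \<inter> space (P t) = Pair t -` X"
      using sets.sets_into_space[OF X] sets_eq_imp_space_eq[OF sP]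
      by (auto simp: space_pair_measure)
    ultimately show "emeasure (K t) X = emeasure (P t) (Pair t -` X)"
      using emeasure_distr[OF m X] by simp
  qed
  finally show "emeasure (joint_law \<pi> Y P) X = (\<integral>\<^sup>+ t. emeasure (P t) (Pair t -` X) \<partial>\<pi>)" .
qed

text \<open>Error and success probabilities are \<pi>-averages over t of section masses, so
  \<open>KL_event_bound\<close> with \<open>c = 2\<close> and r = \<rho> can be integrated term by
  term.\<close>

lemma fano_inequality_joint_law:
  assumes fin: "finite T" and \<pi>: "\<pi> \<in> space (prob_algebra (count_space T))"
    and P: "\<And>t. t \<in> T \<Longrightarrow> P t \<in> space (prob_algebra Y)"
    and est: "est \<in> Y \<rightarrow>\<^sub>M count_space T"
    and Q: "Q \<in> space (prob_algebra Y)"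
    and \<rho>: "0 < rho d \<pi> \<Delta> Q est" "rho d \<pi> \<Delta> Q est < 1"
  shows "fano_bound d \<pi> P \<Delta> Q est
    \<le> ereal (\<P>((t, y) in joint_law \<pi> Y P. d t (est y) \<ge> \<Delta>))"
proof -
  define J where "J = joint_law \<pi> Y P"
  define r where "r = rho d \<pi> \<Delta> Q est"
  define B where "B t = {y \<in> space Y. d t (est y) < \<Delta>}" for t
  define p where "p t = measure (P t) (B t)" for t
  define q where "q t = measure Q (B t)" for t
  \<comment> \<open>\<open>enn2real\<close> sends \<infinity> to 0, so \<open>k\<close> stands for
    the divergence only where that is finite.\<close>
  define k where "k t = enn2real (KL (P t) Q)" for t
  define e where "e = \<P>((t, y) in J. d t (est y) \<ge> \<Delta>)"
  have s\<pi>: "sets \<pi> = sets (count_space T)" and "prob_space \<pi>"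
    using \<pi> by (auto simp: space_prob_algebra)
  interpret \<pi>: prob_space \<pi> by fact
  have sp\<pi>: "space \<pi> = T" using sets_eq_imp_space_eq[OF s\<pi>] by simp
  have sQ: "sets Q = sets Y" and pQ: "prob_space Q"
    using Q by (auto simp: space_prob_algebra)
  interpret Q: prob_space Q by fact
  have sP: "sets (P t) = sets Y" and pP: "prob_space (P t)" if "t \<in> T" for t
    using P[OF that] by (auto simp: space_prob_algebra)
  \<comment> \<open>\<pi> lives on a discrete space; this settles measurability of \<open>p\<close>,
    \<open>q\<close>, \<open>k\<close> and t \<mapsto> \<open>KL (P t) Q\<close> at once.\<close>
  have meas: "f \<in> \<pi> \<rightarrow>\<^sub>M N" if "f \<in> T \<rightarrow> space N" for f :: "'a \<Rightarrow> 'c" and N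
    using that by (simp add: measurable_cong_sets[OF s\<pi> refl])
  have Pm: "P \<in> count_space T \<rightarrow>\<^sub>M prob_algebra Y" using P by auto
  have J: "J \<in> space (prob_algebra (\<pi> \<Otimes>\<^sub>M Y))"
    unfolding J_def by (rule joint_law_in_prob_algebra[OF \<pi> Pm])
  then have sJ: "space J = T \<times> space Y" and "prob_space J"
    using sp\<pi> by (auto simp: space_prob_algebra space_pair_measure dest: sets_eq_imp_space_eq)
  interpret J: prob_space J by fact
  have dm: "(\<lambda>(t, y). d t (est y)) \<in> borel_measurable (\<pi> \<Otimes>\<^sub>M Y)"
    by (rule borel_measurable_pair_finite[OF fin s\<pi> est])
  have Bm: "B t \<in> sets Y" if "t \<in> T" for t
  proof -
    have "(\<lambda>y. d t (est y)) \<in> borel_measurable Y"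
      using measurable_compose[OF est, of "d t" borel] by simp
    then show ?thesis unfolding B_def by measurable
  qed
  have ip: "integrable \<pi> p" and iq: "integrable \<pi> q"
  proof -
    have "AE t in \<pi>. norm (p t) \<le> 1" "AE t in \<pi>. norm (q t) \<le> 1"
      using pP by (auto simp: p_def q_def sp\<pi> intro!: AE_I2 prob_space.prob_le_1)
    then show "integrable \<pi> p" "integrable \<pi> q"
      by (auto intro!: \<pi>.integrable_const_bound meas)
  qed
  have e: "e = 1 - (\<integral>t. p t \<partial>\<pi>)"
  proof -
    have "{z \<in> space (\<pi> \<Otimes>\<^sub>M Y). \<Delta> \<le> (case z of (t, y) \<Rightarrow> d t (est y))} \<in> sets (\<pi> \<Otimes>\<^sub>M Y)"
      using dm by measurable
    then have S: "{z \<in> space J. case z of (t, y) \<Rightarrow> \<Delta> \<le> d t (est y)} \<in> sets (\<pi> \<Otimes>\<^sub>M Y)" (is "?S \<in> _")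
      by (simp add: sJ space_pair_measure sp\<pi> case_prod_unfold)
    have "emeasure J ?S = (\<integral>\<^sup>+ t. emeasure (P t) (Pair t -` ?S) \<partial>\<pi>)"
      unfolding J_def by (rule emeasure_joint_law[OF \<pi> Pm S[unfolded J_def]])
    also have "\<dots> = (\<integral>\<^sup>+ t. ennreal (1 - p t) \<partial>\<pi>)"
    proof (rule nn_integral_cong)
      fix t assume "t \<in> space \<pi>"
      then have t: "t \<in> T" by (simp add: sp\<pi>)
      interpret Pt: prob_space "P t" using pP[OF t] .
      have spt: "space (P t) = space Y" using sets_eq_imp_space_eq[OF sP[OF t]] .
      \<comment> \<open>The section of the error event at t is the complement of the success event
        \<open>B t\<close>.\<close>
      have "Pair t -` ?S = space (P t) - B t" using t by (auto simp: sJ B_def spt)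
      then show "emeasure (P t) (Pair t -` ?S) = ennreal (1 - p t)"
        using Pt.prob_compl[of "B t"] Bm[OF t] sP[OF t]
        by (simp add: Pt.emeasure_eq_measure p_def)
    qed
    finally have "measure J ?S = enn2real (\<integral>\<^sup>+ t. ennreal (1 - p t) \<partial>\<pi>)"
      by (simp only: measure_def)
    moreover have "e = measure J ?S"
      unfolding e_def by (rule arg_cong[where f = "measure J"]) auto
    ultimately have "e = enn2real (\<integral>\<^sup>+ t. ennreal (1 - p t) \<partial>\<pi>)" by simp
    also have "\<dots> = (\<integral>t. 1 - p t \<partial>\<pi>)"
      using pP by (intro integral_eq_nn_integral[symmetric] AE_I2 meas)
        (auto simp: p_def sp\<pi> prob_space.prob_le_1)
    also have "\<dots> = 1 - (\<integral>t. p t \<partial>\<pi>)"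
      using ip by (simp add: \<pi>.prob_space)
    finally show ?thesis .
  qed
  have r: "r = (\<integral>t. q t \<partial>\<pi>)"
  proof -
    have sets: "sets (\<pi> \<Otimes>\<^sub>M Q) = sets (\<pi> \<Otimes>\<^sub>M Y)" using sQ by (intro sets_pair_measure_cong) auto
    have "{z \<in> space (\<pi> \<Otimes>\<^sub>M Y). (case z of (t, y) \<Rightarrow> d t (est y)) < \<Delta>} \<in> sets (\<pi> \<Otimes>\<^sub>M Y)"
      using dm by measurable
    then have S: "{z \<in> space (\<pi> \<Otimes>\<^sub>M Q). case z of (t, y) \<Rightarrow> d t (est y) < \<Delta>} \<in> sets (\<pi> \<Otimes>\<^sub>M Q)"
      (is "?S \<in> _")
      using sets_eq_imp_space_eq[OF sets] by (simp add: sets case_prod_unfold)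
    \<comment> \<open>Independence of t and y makes this the product-measure section formula, whose
      sections are the \<open>B t\<close>.\<close>
    have "emeasure (\<pi> \<Otimes>\<^sub>M Q) ?S = (\<integral>\<^sup>+ t. emeasure Q (Pair t -` ?S) \<partial>\<pi>)"
      by (rule Q.emeasure_pair_measure_alt[OF S])
    also have "\<dots> = (\<integral>\<^sup>+ t. ennreal (q t) \<partial>\<pi>)"
    proof (rule nn_integral_cong)
      fix t assume "t \<in> space \<pi>"
      then have "Pair t -` ?S = B t"
        using sets_eq_imp_space_eq[OF sQ] by (auto simp: B_def space_pair_measure)
      then show "emeasure Q (Pair t -` ?S) = ennreal (q t)"
        by (simp add: Q.emeasure_eq_measure q_def)
    qed
    finally have "measure (\<pi> \<Otimes>\<^sub>M Q) ?S = enn2real (\<integral>\<^sup>+ t. ennreal (q t) \<partial>\<pi>)"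
      by (simp only: measure_def)
    moreover have "r = measure (\<pi> \<Otimes>\<^sub>M Q) ?S"
      unfolding r_def rho_def by (rule arg_cong[where f = "measure (\<pi> \<Otimes>\<^sub>M Q)"]) auto
    ultimately have "r = enn2real (\<integral>\<^sup>+ t. ennreal (q t) \<partial>\<pi>)" by simp
    also have "\<dots> = (\<integral>t. q t \<partial>\<pi>)"
      by (intro integral_eq_nn_integral[symmetric] AE_I2 meas) (auto simp: q_def)
    finally show ?thesis .
  qed
  have r01: "0 < r" "r < 1" using \<rho> by (simp_all add: r_def)
  have lp: "0 < ln (1 / r)" using r01 by simp
  have e0: "0 \<le> e" by (simp add: e_def)
  have "1 - (enn2ereal (avg_KL \<pi> P Q) + ereal (ln 2)) / ereal (ln (1 / r)) \<le> ereal e"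
  proof (cases "avg_KL \<pi> P Q = \<infinity>")
    \<comment> \<open>As ln (1 / r) > 0, the quotient is \<infinity> and the left-hand side is
      -\<infinity>.\<close>
    case True
    then show ?thesis using lp by (simp add: one_ereal_def)
  next
    case False
    have Km: "(\<lambda>t. KL (P t) Q) \<in> borel_measurable \<pi>" by (rule meas) simp
    \<comment> \<open>Divergences may still be infinite at points of zero prior mass, so the later
      steps hold only \<pi>-a.e.\<close>
    have AEfin: "AE t in \<pi>. KL (P t) Q \<noteq> \<infinity>"
      using nn_integral_noteq_infinite[OF Km] False by (simp add: avg_KL_def)
    have "(\<integral>\<^sup>+ t. ennreal (k t) \<partial>\<pi>) = avg_KL \<pi> P Q"
      unfolding avg_KL_def
    proof (rule nn_integral_cong_AE)
      show "AE t in \<pi>. ennreal (k t) = KL (P t) Q"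
        using AEfin by eventually_elim (simp add: k_def less_top)
    qed
    moreover have "(\<integral>t. k t \<partial>\<pi>) = enn2real (\<integral>\<^sup>+ t. ennreal (k t) \<partial>\<pi>)"
      by (intro integral_eq_nn_integral AE_I2 meas) (auto simp: k_def)
    ultimately have I: "(\<integral>t. k t \<partial>\<pi>) = enn2real (avg_KL \<pi> P Q)"
      and ik: "integrable \<pi> k"
      using False by (auto intro!: integrableI_nonneg meas simp: k_def less_top)
    have I': "enn2ereal (avg_KL \<pi> P Q) = ereal (\<integral>t. k t \<partial>\<pi>)"
      using False unfolding I by (cases "avg_KL \<pi> P Q") (auto simp: enn2ereal_ennreal)
    \<comment> \<open>The tangent point 2 bounds the averaged exponential moment 2 - r, and produces
      the ln 2 of the claim.\<close>
    have "(\<integral>t. p t * ln (1 / r) \<partial>\<pi>)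
      \<le> (\<integral>t. k t + (1 + q t * (1 / r - 1)) / 2 + ln 2 - 1 \<partial>\<pi>)"
    proof (rule integral_mono_AE)
      show "AE t in \<pi>. p t * ln (1 / r) \<le> k t + (1 + q t * (1 / r - 1)) / 2 + ln 2 - 1"
        using AEfin AE_space
      proof eventually_elim
        case (elim t)
        then have t: "t \<in> T" by (simp add: sp\<pi>)
        show ?case
          using KL_event_bound[OF pP[OF t] pQ _ _ elim(1) r01(1), of "B t" 2] sP[OF t] sQ Bm[OF t]
          by (simp add: p_def q_def k_def)
      qed
    qed (use ip iq ik in auto)
    also have "\<dots> = (\<integral>t. k t \<partial>\<pi>) + (1 + r * (1 / r - 1)) / 2 + ln 2 - 1"
      using iq ik by (simp add: \<pi>.prob_space r)
    \<comment> \<open>Here (1 + r (1 / r - 1)) / 2 = (2 - r) / 2 \<le> 1 is absorbed by the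
      -1.\<close>
    also have "\<dots> \<le> (\<integral>t. k t \<partial>\<pi>) + ln 2"
      using r01 by (simp add: field_simps)
    finally have "(1 - e) * ln (1 / r) \<le> (\<integral>t. k t \<partial>\<pi>) + ln 2"
      using ip e by simp
    then have "1 - ((\<integral>t. k t \<partial>\<pi>) + ln 2) / ln (1 / r) \<le> e"
      using pos_le_divide_eq[OF lp, of "1 - e" "(\<integral>t. k t \<partial>\<pi>) + ln 2"] by linarith
    then show ?thesis using lp r01 unfolding I' by (simp add: one_ereal_def)
  qed
  \<comment> \<open>Nonnegativity of \<open>e\<close> accounts for the positive part.\<close>
  with e0 show ?thesis
    by (simp add: fano_bound_def r_def e_def J_def)
qed

theorem proposition1p4:
  fixes T :: "'a set" and d :: "'a \<Rightarrow> 'a \<Rightarrow> real" and \<pi> :: "'a measure"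
    and Y :: "'b measure" and P :: "'a \<Rightarrow> 'b measure" and est :: "'b \<Rightarrow> 'a"
  assumes "Metric_space T d" and "finite T"
    and "\<pi> \<in> space (prob_algebra (count_space T))"
    and "\<And>t. t \<in> T \<Longrightarrow> P t \<in> space (prob_algebra Y)"
    and "est \<in> Y \<rightarrow>\<^sub>M count_space T"
  shows "(\<forall>\<Delta> Q. \<Delta> > 0 \<longrightarrow> Q \<in> space (prob_algebra Y) \<longrightarrow>
            0 < rho d \<pi> \<Delta> Q est \<longrightarrow> rho d \<pi> \<Delta> Q est < 1 \<longrightarrow>
            ereal (\<P>((t, y) in joint_law \<pi> Y P. d t (est y) \<ge> \<Delta>))
              \<ge> fano_bound d \<pi> P \<Delta> Q est)
       \<and> ereal (\<integral>(t, y). d t (est y) \<partial>joint_law \<pi> Y P)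
            \<ge> (SUP (\<Delta>, Q) \<in> {(\<Delta>, Q). \<Delta> > 0 \<and> Q \<in> space (prob_algebra Y) \<and>
                                    0 < rho d \<pi> \<Delta> Q est \<and> rho d \<pi> \<Delta> Q est < 1}.
                 ereal \<Delta> * fano_bound d \<pi> P \<Delta> Q est)"
\<comment> \<open>\<open>SUP_least\<close> leaves one bound per admissible pair; over an empty index
  set the supremum is -\<infinity>.\<close>
proof (intro conjI allI impI SUP_least)
  fix \<Delta> Q
  assume "Q \<in> space (prob_algebra Y)" "0 < rho d \<pi> \<Delta> Q est" "rho d \<pi> \<Delta> Q est < 1"
  then show "fano_bound d \<pi> P \<Delta> Q est
      \<le> ereal (\<P>((t, y) in joint_law \<pi> Y P. d t (est y) \<ge> \<Delta>))"
    using fano_inequality_joint_law[OF assms(2,3) _ assms(5), where P = P] assms(4) by blast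
next
  fix z
  assume z: "z \<in> {(\<Delta>, Q). \<Delta> > 0 \<and> Q \<in> space (prob_algebra Y) \<and>
      0 < rho d \<pi> \<Delta> Q est \<and> rho d \<pi> \<Delta> Q est < 1}"
  obtain \<Delta> Q where zeq: "z = (\<Delta>, Q)" by (cases z)
  define J where "J = joint_law \<pi> Y P"
  let ?u = "\<lambda>(t, y). d t (est y)"
  have s\<pi>: "sets \<pi> = sets (count_space T)"
    using assms(3) by (simp add: space_prob_algebra)
  have Pm: "P \<in> count_space T \<rightarrow>\<^sub>M prob_algebra Y" using assms(4) by auto
  have J: "sets J = sets (\<pi> \<Otimes>\<^sub>M Y)" "prob_space J"
    using joint_law_in_prob_algebra[OF assms(3) Pm] by (simp_all add: J_def space_prob_algebra)
  interpret J: prob_space J by fact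
  have um: "?u \<in> borel_measurable J"
    using borel_measurable_pair_finite[OF assms(2) s\<pi> assms(5), of d]
      measurable_cong_sets[OF J(1) refl] by blast
  \<comment> \<open>\<open>Metric_space\<close> makes \<open>d\<close> nonnegative at all arguments,
    so \<open>z\<close> need not lie in the space of \<open>J\<close>.\<close>
  have nonneg: "0 \<le> ?u z" for z
    using Metric_space.nonneg[OF assms(1)] by (simp add: case_prod_unfold)
  \<comment> \<open>The loss is at most the diameter of the finite set \<open>T\<close>.
    Integrability is what Markov's inequality requires, and it rules out the default value 0 of the
    integral.\<close>
  have int: "integrable J ?u"
  proof (rule J.integrable_const_bound[OF AE_I2 um])
    fix z assume "z \<in> space J"
    then have "fst z \<in> T" "est (snd z) \<in> T"
      using sets_eq_imp_space_eq[OF J(1)] sets_eq_imp_space_eq[OF s\<pi>] measurable_space[OF assms(5)]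
      by (auto simp: space_pair_measure)
    then have "?u z \<le> Max (case_prod d ` (T \<times> T))"
      using assms(2) by (intro Max_ge) (auto simp: case_prod_unfold intro!: image_eqI[of _ _ "(fst z, est (snd z))"])
    then show "norm (?u z) \<le> Max (case_prod d ` (T \<times> T))" using nonneg[of z] by simp
  qed
  have \<Delta>: "0 < \<Delta>" using z zeq by simp
  have "\<P>((t, y) in J. \<Delta> \<le> d t (est y)) \<le> (\<integral>z. ?u z \<partial>J) / \<Delta>"
    using integral_Markov_inequality_measure[OF int sets.empty_sets _ \<Delta>] nonneg
    by (simp add: case_prod_unfold)
  then have M: "\<Delta> * \<P>((t, y) in J. \<Delta> \<le> d t (est y)) \<le> (\<integral>z. ?u z \<partial>J)"
    using \<Delta> by (simp add: field_simps)
  have "ereal \<Delta> * fano_bound d \<pi> P \<Delta> Q est \<le> ereal \<Delta> * ereal (\<P>((t, y) in J. \<Delta> \<le> d t (est y)))"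
    using fano_inequality_joint_law[OF assms(2,3) _ assms(5), where P = P and d = d and \<Delta> = \<Delta> and Q = Q]
      assms(4) z zeq \<Delta>
    by (intro ereal_mult_left_mono) (auto simp: J_def)
  also have "\<dots> \<le> ereal (\<integral>z. ?u z \<partial>J)" using M by simp
  finally show "(case z of (\<Delta>, Q) \<Rightarrow> ereal \<Delta> * fano_bound d \<pi> P \<Delta> Q est)
      \<le> ereal (\<integral>(t, y). d t (est y) \<partial>joint_law \<pi> Y P)"
    by (simp add: zeq J_def)
qed

end
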